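(* For all integers $n\ge 1$ and $0\le k\le n^2$, $$i_{B_q}(n,k)=\sum_{T\in\mathcal{T}^{B}_{n,k}}q^{\omega_T}.$$
   Context: $B_n$ is the hyperoctahedral group: the group of bijections $\pi$ of $\{-n,\ldots,-1,1,\ldots,n\}$ with $\pi(-j)=-\pi(j)$ for all $j\in\{1,\dots,n\}$. Every $\pi\in B_n$ is written uniquely as $\pi(p)=(-1)^{r_p}\sigma_p$ for $1\le p\le n$, with $r_p\in\{0,1\}$ and $\sigma=\sigma_1\cdots\sigma_n$ a permutation of $\{1,\dots,n\}$. For $1\le i\le n$ put $m=n+1-i$ and $inv_i(\sigma)=|\{j: j<m,\ \sigma_j>\sigma_m\}|$, and define $inv_i(\pi)=inv_i(\sigma)$ if $r_m=0$, and $inv_i(\pi)=1+2|\{j: j<m,\ \sigma_j<\sigma_m\}|+inv_i(\sigma)$ if $r_m=1$. Put $inv_B(\pi)=\sum_{i=1}^n inv_i(\pi)$, $I_B(n,k)=\{\pi\in B_n: inv_B(\pi)=k\}$ and $\omega(\pi)=\sum_{i=1}^n(n-i+1)\,inv_i(\pi)$. With $q$ an indeterminate, the $q$-Mahonian number of type $B$ is $i_{B_q}(n,k)=\sum_{\pi\in I_B(n,k)}q^{\omega(\pi)}$. $\mathcal{T}^{B}_{n,k}$ is the set of tilings of an $(n+k)\times 1$-board (equivalently, words of length $n+k$ in the letters green, orange) with exactly $n$ green squares and $k$ orange squares, such that every nonempty maximal run of consecutive orange squares having exactly $j$ green squares to its left has length at most $2j-1$ (in particular no orange square precedes the first green square).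 The weight $\omega_T$ of a tiling $T$ is the sum of the weights of its orange squares, where the weight of an orange square is the number of green squares to its left. *)

theory Defs
  imports "HOL-Combinatorics.Permutations" "HOL-Computational_Algebra.Polynomial"
begin

text \<open>A signed permutation is extended to all of \<^typ>\<open>int\<close> by the identity (this is what
  \<^const>\<open>permutes\<close> demands), so that distinct functions are distinct group elements.\<close>

definition hyperoctahedral :: "nat \<Rightarrow> (int \<Rightarrow> int) set" where
  "hyperoctahedral n =
     {\<pi>. \<pi> permutes ({- int n..-1} \<union> {1..int n}) \<and> (\<forall>j\<in>{1..int n}. \<pi> (- j) = - \<pi> j)}"

definition sign_exp :: "(int \<Rightarrow> int) \<Rightarrow> nat \<Rightarrow> nat" where
  "sign_exp \<pi> p = (if \<pi> (int p) < 0 then 1 else 0)"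

definition underlying :: "(int \<Rightarrow> int) \<Rightarrow> nat \<Rightarrow> nat" where
  "underlying \<pi> p = nat \<bar>\<pi> (int p)\<bar>"

lemma signed_decomposition:
  "\<pi> (int p) = (-1) ^ sign_exp \<pi> p * int (underlying \<pi> p)"
  by (simp add: sign_exp_def underlying_def)

definition perm_inv :: "nat \<Rightarrow> (nat \<Rightarrow> nat) \<Rightarrow> nat \<Rightarrow> nat" where
  "perm_inv n \<sigma> i = (let m = n + 1 - i in card {j. 1 \<le> j \<and> j < m \<and> \<sigma> j > \<sigma> m})"

definition signed_inv :: "nat \<Rightarrow> (int \<Rightarrow> int) \<Rightarrow> nat \<Rightarrow> nat" where
  "signed_inv n \<pi> i =
     (let m = n + 1 - i; \<sigma> = underlying \<pi> in
      if sign_exp \<pi> m = 0 then perm_inv n \<sigma> i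
      else 1 + 2 * card {j. 1 \<le> j \<and> j < m \<and> \<sigma> j < \<sigma> m} + perm_inv n \<sigma> i)"

definition inv_B :: "nat \<Rightarrow> (int \<Rightarrow> int) \<Rightarrow> nat" where
  "inv_B n \<pi> = (\<Sum>i=1..n. signed_inv n \<pi> i)"

definition I_B :: "nat \<Rightarrow> nat \<Rightarrow> (int \<Rightarrow> int) set" where
  "I_B n k = {\<pi> \<in> hyperoctahedral n. inv_B n \<pi> = k}"

definition inv_weight :: "nat \<Rightarrow> (int \<Rightarrow> int) \<Rightarrow> nat" where
  "inv_weight n \<pi> = (\<Sum>i=1..n. (n - i + 1) * signed_inv n \<pi> i)"

text \<open>The indeterminate $q$ is the generator of \<^typ>\<open>int poly\<close>.\<close>

definition q :: "int poly" where
  "q = [:0, 1:]"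

definition q_mahonian_B :: "nat \<Rightarrow> nat \<Rightarrow> int poly" where
  "q_mahonian_B n k = (\<Sum>\<pi>\<in>I_B n k. q ^ inv_weight n \<pi>)"

datatype square = Green | Orange

text \<open>A nonempty maximal run of orange squares in \<open>T\<close> is a factorisation
  \<open>T = u @ replicate l Orange @ v\<close> with \<open>l > 0\<close> that extends neither to the left nor to the
  right. The bound is stated over \<^typ>\<open>int\<close> because \<open>2 * j - 1\<close> is negative for \<open>j = 0\<close>.\<close>

definition tilings_B :: "nat \<Rightarrow> nat \<Rightarrow> square list set" where
  "tilings_B n k =
     {T. length T = n + k \<and> count_list T Green = n \<and> count_list T Orange = k \<and>
         (\<forall>u l v. T = u @ replicate l Orange @ v \<and> l > 0 \<and>
                  (u = [] \<or> last u \<noteq> Orange) \<and> (v = [] \<or> hd v \<noteq> Orange)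
            \<longrightarrow> int l \<le> 2 * int (count_list u Green) - 1)}"

definition tiling_weight :: "square list \<Rightarrow> nat" where
  "tiling_weight T =
     (\<Sum>p | p < length T \<and> T ! p = Orange. count_list (take p T) Green)"

end

theory Submission
  imports Defs "HOL-Library.FuncSet"
begin

text \<open>Both sides count the same integer sequences. Let \<open>x m\<close> be the contribution of position \<open>m\<close> to
  \<open>inv_B\<close>, that is, \<open>signed_inv\<close> at index \<open>n + 1 - m\<close>. If \<open>c\<close> is the number of earlier positions
  with a larger absolute value, so that \<open>c < m\<close> and \<open>m - 1 - c\<close> earlier ones are smaller, then
  \<open>x m = c\<close> for a positive entry and \<open>x m = 1 + 2 (m - 1 - c) + c = 2 m - 1 - c\<close> for a negative
  one. The positive entries thus fill the values \<open>0, \<dots>, m - 1\<close> and the negative ones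
  \<open>m, \<dots>, 2 m - 1\<close>, so \<open>x m\<close> records the sign together with the ordinary Lehmer code. As a
  permutation is determined by its Lehmer code, \<open>\<pi> \<mapsto> x\<close> is injective; comparing cardinalities, both
  equal to \<open>2 ^ n * n!\<close>, shows that it is a bijection onto the sequences with \<open>x m < 2 m\<close>
  (\<open>bij_betw_code_B\<close>). It turns \<open>inv_B\<close> into the sum of the \<open>x m\<close> and \<open>inv_weight\<close> into the sum of
  the \<open>m * x m\<close>.

  On the other side, a tiling in which no orange square comes first is a concatenation of \<open>n\<close> blocks,
  the \<open>m\<close>-th of which is a green square followed by \<open>x m\<close> orange ones. These orange squares have
  \<open>m\<close> green squares to their left, so the bound on the runs says \<open>x m \<le> 2 m - 1\<close>, the number of orange
  squares is the sum of the \<open>x m\<close>, and the weight is the sum of the \<open>m * x m\<close>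
  (\<open>bij_betw_codes_tilings\<close>, \<open>tiling_weight_block_word\<close>).\<close>

section \<open>Words as sequences of blocks\<close>

definition runs_bounded :: "square list \<Rightarrow> bool" where
  "runs_bounded T \<longleftrightarrow>
     (\<forall>u l v. T = u @ replicate l Orange @ v \<and> l > 0 \<and>
              (u = [] \<or> last u \<noteq> Orange) \<and> (v = [] \<or> hd v \<noteq> Orange)
        \<longrightarrow> int l \<le> 2 * int (count_list u Green) - 1)"

lemma not_Orange_iff [simp]: "c \<noteq> Orange \<longleftrightarrow> c = Green"
  by (cases c) auto

lemma Green_notin_imp_replicate:
  assumes "Green \<notin> set s"
  shows "s = replicate (length s) Orange"
  using assms by (intro replicate_eqI) (auto, metis square.exhaust)

lemma split_at_last_unique:
  assumes "u @ x # s = v @ x # t" "x \<notin> set s" "x \<notin> set t"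
  shows "u = v \<and> s = t"
  using assms by (auto simp: append_eq_append_conv2 Cons_eq_append_conv append_eq_Cons_conv)

lemma runs_bounded_replicate: "runs_bounded (replicate k Orange) \<longleftrightarrow> k = 0"
proof
  assume "runs_bounded (replicate k Orange)"
  then have "replicate k Orange = [] @ replicate k Orange @ [] \<and> k > 0 \<Longrightarrow> int k \<le> 2 * int (count_list [] Green) - 1"
    unfolding runs_bounded_def by blast
  then show "k = 0" by (cases "k = 0") auto
qed (auto simp: runs_bounded_def)

text \<open>The run condition quantifies over all factorisations of a word. Splitting off the last green square
  makes it local: the final stretch of orange squares is constrained only by the number of green
  squares, and all other runs lie in the prefix.\<close>

lemma runs_bounded_append_block:
  "runs_bounded (w @ Green # replicate a Orange) \<longleftrightarrow>
     runs_bounded w \<and> a < 2 * Suc (count_list w Green)"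
proof (intro iffI conjI)
  assume R: "runs_bounded (w @ Green # replicate a Orange)"
  show "runs_bounded w"
    unfolding runs_bounded_def
  proof (intro allI impI, elim conjE)
    fix u l v
    assume "w = u @ replicate l Orange @ v" "0 < l" "u = [] \<or> last u \<noteq> Orange" "v = [] \<or> hd v \<noteq> Orange"
    then show "int l \<le> 2 * int (count_list u Green) - 1"
      using R[unfolded runs_bounded_def, rule_format, of u l "v @ Green # replicate a Orange"]
      by (cases v) auto
  qed
  show "a < 2 * Suc (count_list w Green)"
    \<comment> \<open>The empty stretch is no run, but its bound holds because \<open>w @ [Green]\<close> has a green square.\<close>
    using R[unfolded runs_bounded_def, rule_format, of "w @ [Green]" a "[]"]
    by (cases "a = 0") auto
next
  assume R: "runs_bounded w \<and> a < 2 * Suc (count_list w Green)"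
  show "runs_bounded (w @ Green # replicate a Orange)"
    unfolding runs_bounded_def
  proof (intro allI impI, elim conjE)
    fix u l v
    assume eq: "w @ Green # replicate a Orange = u @ replicate l Orange @ v" and l: "0 < l"
      and u: "u = [] \<or> last u \<noteq> Orange" and v: "v = [] \<or> hd v \<noteq> Orange"
    show "int l \<le> 2 * int (count_list u Green) - 1"
    \<comment> \<open>The run lies inside \<open>w\<close> exactly if a green square follows it; otherwise it is the last stretch.\<close>
    proof (cases "Green \<in> set v")
      case True
      then obtain s t where vst: "v = s @ Green # t" "Green \<notin> set t"
        by (meson split_list_last)
      have "w @ Green # replicate a Orange = (u @ replicate l Orange @ s) @ Green # t"
        using eq vst by simp
      then have "w = u @ replicate l Orange @ s \<and> replicate a Orange = t"
        by (rule split_at_last_unique) (use vst(2) in auto)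
      then have "w = u @ replicate l Orange @ s" ..
      moreover have "s = [] \<or> hd s \<noteq> Orange"
        using v vst by (cases s) auto
      ultimately show ?thesis
        using R l u unfolding runs_bounded_def by blast
    next
      case False
      then have v0: "v = []" using v by (cases v) auto
      have "Green \<in> set (u @ replicate l Orange @ v)"
        unfolding eq[symmetric] by simp
      then have "u \<noteq> []" using v0 by auto
      \<comment> \<open>By maximality to the left, the run starts right after a green square, which is the last one.\<close>
      then obtain u' where u': "u = u' @ [Green]"
        using u by (metis append_butlast_last_id not_Orange_iff)
      have "w @ Green # replicate a Orange = u' @ Green # replicate l Orange"
        using eq u' v0 by simp
      then have "w = u' \<and> replicate a Orange = replicate l Orange"
        by (rule split_at_last_unique) auto
      then have "w = u'" "a = l" by (auto simp: replicate_eq_replicate)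
      then show ?thesis using R u' by auto
    qed
  qed
qed

fun block_word :: "(nat \<Rightarrow> nat) \<Rightarrow> nat \<Rightarrow> square list" where
  "block_word x 0 = []"
| "block_word x (Suc n) = block_word x n @ Green # replicate (x (Suc n)) Orange"

lemma count_list_replicate_square:
  "count_list (replicate a c) d = (if c = d then a else 0)"
  by (induction a) auto

lemma count_Green_block_word [simp]: "count_list (block_word x n) Green = n"
  by (induction n) (auto simp: count_list_replicate_square)

lemma count_Orange_block_word: "count_list (block_word x n) Orange = (\<Sum>m=1..n. x m)"
  by (induction n) (auto simp: count_list_replicate_square)

lemma length_eq_counts: "length T = count_list T Green + count_list T Orange"
  by (induction T) auto

lemma runs_bounded_block_word:
  "runs_bounded (block_word x n) \<longleftrightarrow> (\<forall>m\<in>{1..n}. x m < 2 * m)"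
proof (induction n)
  case 0
  show ?case using runs_bounded_replicate[of 0] by simp
next
  case (Suc n)
  have "{1..Suc n} = insert (Suc n) {1..n}"
    by (rule atLeastAtMostSuc_conv) simp
  then have "(\<forall>m\<in>{1..Suc n}. x m < 2 * m) \<longleftrightarrow> x (Suc n) < 2 * Suc n \<and> (\<forall>m\<in>{1..n}. x m < 2 * m)"
    by (simp only: ball_simps)
  then show ?case
    by (simp only: block_word.simps runs_bounded_append_block count_Green_block_word Suc.IH conj_commute)
qed

lemma block_word_cong:
  "(\<And>m. m \<in> {1..n} \<Longrightarrow> x m = y m) \<Longrightarrow> block_word x n = block_word y n"
  by (induction n) auto

lemma block_word_eqD:
  "block_word x n = block_word y n \<Longrightarrow> m \<in> {1..n} \<Longrightarrow> x m = y m"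
proof (induction n)
  case (Suc n)
  have "block_word x n = block_word y n \<and> replicate (x (Suc n)) Orange = replicate (y (Suc n)) Orange"
    using Suc.prems(1) by (intro split_at_last_unique[where x = Green]) auto
  then show ?case using Suc by (auto simp: replicate_eq_replicate le_Suc_eq)
qed auto

text \<open>The run condition excludes orange squares before the first green one, so cutting before each green
  square leaves no remainder.\<close>

lemma ex_block_word:
  assumes "runs_bounded T" "count_list T Green = n"
  shows "\<exists>x. T = block_word x n"
  using assms
proof (induction n arbitrary: T)
  case 0
  then have "T = replicate (length T) Orange"
    by (intro Green_notin_imp_replicate) (simp add: count_list_0_iff)
  then show ?case using 0 runs_bounded_replicate by (metis block_word.simps(1) length_0_conv)
next
  case (Suc n)
  then have "Green \<in> set T" by (metis count_list_0_iff nat.distinct(1))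
  then obtain w s where T: "T = w @ Green # s" "Green \<notin> set s"
    by (meson split_list_last)
  define a where "a = length s"
  have s: "s = replicate a Orange"
    unfolding a_def by (rule Green_notin_imp_replicate) fact
  have "runs_bounded w" "count_list w Green = n"
    using Suc.prems unfolding T s
    by (auto simp: runs_bounded_append_block count_list_replicate_square)
  then obtain x where x: "w = block_word x n" using Suc.IH by blast
  have "block_word (x(Suc n := a)) n = block_word x n"
    by (rule block_word_cong) auto
  then have "T = block_word (x(Suc n := a)) (Suc n)" using T s x by simp
  then show ?case by blast
qed

lemma tiling_weight_snoc:
  "tiling_weight (T @ [c]) = tiling_weight T + (if c = Orange then count_list T Green else 0)"
proof -
  have "{p. p < length (T @ [c]) \<and> (T @ [c]) ! p = Orange} =
      {p. p < length T \<and> T ! p = Orange} \<union> (if c = Orange then {length T} else {})"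
    by (auto simp: nth_append less_Suc_eq split: if_splits)
  then show ?thesis
    unfolding tiling_weight_def by (auto simp: sum.union_disjoint intro!: sum.cong)
qed

lemma tiling_weight_append_Oranges:
  "tiling_weight (T @ replicate a Orange) = tiling_weight T + count_list T Green * a"
proof (induction a)
  case (Suc a)
  have "T @ replicate (Suc a) Orange = (T @ replicate a Orange) @ [Orange]"
    by (simp add: replicate_append_same)
  then show ?case
    using Suc by (simp only: tiling_weight_snoc) (simp add: count_list_replicate_square)
qed simp

lemma tiling_weight_block_word:
  "tiling_weight (block_word x n) = (\<Sum>m=1..n. m * x m)"
proof (induction n)
  case 0
  show ?case by (simp add: tiling_weight_def)
next
  case (Suc n)
  have "block_word x (Suc n) = (block_word x n @ [Green]) @ replicate (x (Suc n)) Orange"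
    by simp
  then show ?case
    using Suc by (simp only: tiling_weight_append_Oranges tiling_weight_snoc) simp
qed

section \<open>Inversion codes of type B\<close>

definition codes_B :: "nat \<Rightarrow> (nat \<Rightarrow> nat) set" where
  "codes_B n = (\<Pi>\<^sub>E m\<in>{1..n}. {..<2 * m})"

lemma bij_betw_codes_tilings:
  "bij_betw (\<lambda>x. block_word x n) {x \<in> codes_B n. (\<Sum>m=1..n. x m) = k} (tilings_B n k)"
proof (rule bij_betw_imageI)
  show "inj_on (\<lambda>x. block_word x n) {x \<in> codes_B n. (\<Sum>m=1..n. x m) = k}"
  proof (rule inj_onI)
    fix x y
    assume "x \<in> {x \<in> codes_B n. (\<Sum>m=1..n. x m) = k}" "y \<in> {x \<in> codes_B n. (\<Sum>m=1..n. x m) = k}"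
      and eq: "block_word x n = block_word y n"
    then have "x \<in> codes_B n" "y \<in> codes_B n" by auto
    then show "x = y"
      unfolding codes_B_def by (rule PiE_ext) (rule block_word_eqD[OF eq])
  qed
  show "(\<lambda>x. block_word x n) ` {x \<in> codes_B n. (\<Sum>m=1..n. x m) = k} = tilings_B n k"
  proof (intro equalityI subsetI)
    fix T assume "T \<in> (\<lambda>x. block_word x n) ` {x \<in> codes_B n. (\<Sum>m=1..n. x m) = k}"
    then obtain x where x: "x \<in> codes_B n" "(\<Sum>m=1..n. x m) = k" "T = block_word x n" by auto
    have "runs_bounded T"
      using x unfolding codes_B_def x(3) runs_bounded_block_word by (auto simp: PiE_iff)
    then show "T \<in> tilings_B n k"
      using x length_eq_counts[of T]
      by (simp add: tilings_B_def runs_bounded_def count_Orange_block_word)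
  next
    fix T assume T: "T \<in> tilings_B n k"
    have R: "runs_bounded T" using T unfolding tilings_B_def runs_bounded_def by blast
    then obtain x where x: "T = block_word x n"
      using ex_block_word T unfolding tilings_B_def by blast
    have eq: "T = block_word (restrict x {1..n}) n"
      unfolding x by (rule block_word_cong) auto
    have "restrict x {1..n} \<in> codes_B n"
      using R unfolding codes_B_def x runs_bounded_block_word by auto
    moreover have "(\<Sum>m=1..n. restrict x {1..n} m) = k"
      using T count_Orange_block_word[of "restrict x {1..n}" n] unfolding tilings_B_def eq[symmetric]
      by simp
    ultimately show "T \<in> (\<lambda>x. block_word x n) ` {x \<in> codes_B n. (\<Sum>m=1..n. x m) = k}"
      using eq by blast
  qed
qed

definition inversions_at :: "(nat \<Rightarrow> 'a::linorder) \<Rightarrow> nat \<Rightarrow> nat" where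
  "inversions_at \<sigma> m = card {j. 1 \<le> j \<and> j < m \<and> \<sigma> j > \<sigma> m}"

lemma inversions_at_less:
  assumes "m \<ge> 1"
  shows "inversions_at \<sigma> m < m"
proof -
  have "inversions_at \<sigma> m \<le> card {1..<m}"
    unfolding inversions_at_def by (intro card_mono) auto
  then show ?thesis using assms by simp
qed

lemma card_greater_inj:
  fixes a b :: "'a::linorder"
  assumes "finite A" "a \<in> A" "b \<in> A" "card {c\<in>A. c > a} = card {c\<in>A. c > b}"
  shows "a = b"
proof -
  have "\<not> a < b" if "a \<in> A" "b \<in> A" "card {c\<in>A. c > a} = card {c\<in>A. c > b}" for a b
  proof
    assume "a < b"
    then have "{c\<in>A. c > b} \<subset> {c\<in>A. c > a}" using that by auto
    then have "card {c\<in>A. c > b} < card {c\<in>A. c > a}"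
      using assms(1) by (intro psubset_card_mono) auto
    then show False using that by simp
  qed
  from this[of a b] this[of b a] show ?thesis using assms(2-4) by (simp add: not_less)
qed

lemma inversions_at_eq_card_image:
  assumes "inj_on \<sigma> {1..m}" "m \<ge> 1"
  shows "inversions_at \<sigma> m = card {a \<in> \<sigma> ` {1..m}. a > \<sigma> m}"
proof -
  have "{a \<in> \<sigma> ` {1..m}. a > \<sigma> m} = \<sigma> ` {j. 1 \<le> j \<and> j < m \<and> \<sigma> j > \<sigma> m}"
    by (auto simp: order_le_less)
  moreover have "inj_on \<sigma> {j. 1 \<le> j \<and> j < m \<and> \<sigma> j > \<sigma> m}"
    using assms(1) by (rule inj_on_subset) auto
  ultimately show ?thesis by (simp add: card_image inversions_at_def)
qed

text \<open>A permutation is determined by its Lehmer code: the last value is the element of the image with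
  \<open>inversions_at \<sigma> n\<close> larger elements, and once it is removed the argument repeats. The image is an
  arbitrary set because after the removal it is no longer an initial segment.\<close>

lemma inversions_determine_injection:
  assumes "inj_on \<sigma> {1..n}" "inj_on \<tau> {1..n}" "\<sigma> ` {1..n} = \<tau> ` {1..n}"
    and "\<And>m. m \<in> {1..n} \<Longrightarrow> inversions_at \<sigma> m = inversions_at \<tau> m"
    and "m \<in> {1..n}"
  shows "\<sigma> m = \<tau> m"
  using assms
proof (induction n)
  case (Suc n)
  let ?A = "\<sigma> ` {1..Suc n}"
  have last: "\<sigma> (Suc n) = \<tau> (Suc n)"
  proof (rule card_greater_inj)
    show "card {c \<in> ?A. c > \<sigma> (Suc n)} = card {c \<in> ?A. c > \<tau> (Suc n)}"
      using Suc.prems(1-4) inversions_at_eq_card_image[of \<sigma> "Suc n"]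
        inversions_at_eq_card_image[of \<tau> "Suc n"] by simp
    show "\<tau> (Suc n) \<in> ?A" unfolding Suc.prems(3) by simp
  qed auto
  have rest: "f ` {1..n} = f ` {1..Suc n} - {f (Suc n)}" if "inj_on f {1..Suc n}" for f :: "nat \<Rightarrow> 'a"
  proof -
    have "{1..n} = {1..Suc n} - {Suc n}" by auto
    then show ?thesis using inj_on_image_set_diff[OF that, of "{1..Suc n}" "{Suc n}"] by simp
  qed
  have "\<sigma> ` {1..n} = \<tau> ` {1..n}"
    unfolding rest[OF Suc.prems(1)] rest[OF Suc.prems(2)] using last Suc.prems(3) by simp
  moreover have "inj_on \<sigma> {1..n}" "inj_on \<tau> {1..n}"
    using inj_on_subset[OF Suc.prems(1), of "{1..n}"] inj_on_subset[OF Suc.prems(2), of "{1..n}"]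
    by simp_all
  ultimately have "m \<in> {1..n} \<Longrightarrow> \<sigma> m = \<tau> m"
    using Suc.prems(4) by (intro Suc.IH) simp_all
  then show ?case
    using Suc.prems(5) last by (cases "m = Suc n") simp_all
qed auto

text \<open>The index is reversed so that \<open>code_B n \<pi> m\<close> belongs to position \<open>m\<close> of \<open>\<pi>\<close>; the restriction to
  \<open>{1..n}\<close> makes a code a unique element of the extensional product \<open>codes_B n\<close>.\<close>

definition code_B :: "nat \<Rightarrow> (int \<Rightarrow> int) \<Rightarrow> nat \<Rightarrow> nat" where
  "code_B n \<pi> = (\<lambda>m\<in>{1..n}. signed_inv n \<pi> (n + 1 - m))"

lemma inv_B_eq_sum_code: "inv_B n \<pi> = (\<Sum>m=1..n. code_B n \<pi> m)"
  unfolding inv_B_def code_B_def by (subst sum.atLeastAtMost_rev) (auto intro!: sum.cong)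

lemma inv_weight_eq_sum_code: "inv_weight n \<pi> = (\<Sum>m=1..n. m * code_B n \<pi> m)"
  unfolding inv_weight_def code_B_def by (subst sum.atLeastAtMost_rev) (auto intro!: sum.cong)

lemma hyperoctahedralD:
  assumes "\<pi> \<in> hyperoctahedral n"
  shows "underlying \<pi> ` {1..n} \<subseteq> {1..n}" "inj_on (underlying \<pi>) {1..n}"
    "\<And>p. p \<in> {1..n} \<Longrightarrow> \<pi> (- int p) = - \<pi> (int p)"
    "\<And>x. x \<notin> {- int n..-1} \<union> {1..int n} \<Longrightarrow> \<pi> x = x"
proof -
  have perm: "\<pi> permutes ({- int n..-1} \<union> {1..int n})"
    and odd: "\<And>p. p \<in> {1..n} \<Longrightarrow> \<pi> (- int p) = - \<pi> (int p)"
    using assms by (auto simp: hyperoctahedral_def)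
  have inj: "inj \<pi>" using perm by (rule permutes_inj)
  show "\<And>p. p \<in> {1..n} \<Longrightarrow> \<pi> (- int p) = - \<pi> (int p)" by (rule odd)
  show "\<And>x. x \<notin> {- int n..-1} \<union> {1..int n} \<Longrightarrow> \<pi> x = x"
    using perm by (simp add: permutes_def)
  show "underlying \<pi> ` {1..n} \<subseteq> {1..n}"
  proof (intro subsetI, elim imageE)
    fix y p assume "y = underlying \<pi> p" "p \<in> {1..n}"
    moreover from this have "\<pi> (int p) \<in> {- int n..-1} \<union> {1..int n}"
      using permutes_in_image[OF perm] by auto
    ultimately show "y \<in> {1..n}" by (auto simp: underlying_def)
  qed
  show "inj_on (underlying \<pi>) {1..n}"
  proof (rule inj_onI)
    fix p p' assume p: "p \<in> {1..n}" "p' \<in> {1..n}" "underlying \<pi> p = underlying \<pi> p'"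
    then have "\<bar>\<pi> (int p)\<bar> = \<bar>\<pi> (int p')\<bar>"
      by (simp add: underlying_def)
    then have "\<pi> (int p) = \<pi> (int p') \<or> \<pi> (int p) = \<pi> (- int p')"
      unfolding odd[OF p(2)] by (simp only: abs_eq_iff)
    then have "int p = int p' \<or> int p = - int p'" using inj by (simp only: inj_eq)
    then show "p = p'" using p by auto
  qed
qed

lemma underlying_image:
  assumes "\<pi> \<in> hyperoctahedral n"
  shows "underlying \<pi> ` {1..n} = {1..n}"
  using hyperoctahedralD(1,2)[OF assms] by (intro endo_inj_surj) auto

text \<open>The values at the other positions differ from \<open>underlying \<pi> m\<close>, so the numbers of smaller and of
  larger ones among the first \<open>m - 1\<close> add up to \<open>m - 1\<close>. This eliminates the smaller ones from the
  definition.\<close>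

lemma code_B_eq:
  assumes "\<pi> \<in> hyperoctahedral n" "m \<in> {1..n}"
  shows "code_B n \<pi> m =
    (if \<pi> (int m) < 0 then 2 * m - 1 - inversions_at (underlying \<pi>) m
     else inversions_at (underlying \<pi>) m)"
proof -
  let ?\<sigma> = "underlying \<pi>"
  let ?L = "{j. 1 \<le> j \<and> j < m \<and> ?\<sigma> j < ?\<sigma> m}"
  let ?G = "{j. 1 \<le> j \<and> j < m \<and> ?\<sigma> j > ?\<sigma> m}"
  have "j \<in> ?L \<union> ?G" if "j \<in> {1..<m}" for j
    using inj_onD[OF hyperoctahedralD(2)[OF assms(1)], of j m] that assms(2)
    by (cases "?\<sigma> j" "?\<sigma> m" rule: linorder_cases) auto
  then have "{1..<m} \<subseteq> ?L \<union> ?G" by (rule subsetI)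
  moreover have "?L \<union> ?G \<subseteq> {1..<m}" by auto
  ultimately have "{1..<m} = ?L \<union> ?G" by (rule equalityI)
  then have "card {1..<m} = card (?L \<union> ?G)" by (rule arg_cong)
  also have "\<dots> = card ?L + card ?G"
    by (rule card_Un_disjoint) auto
  finally have "card ?L + card ?G = m - 1" by simp
  then have "1 + 2 * card ?L + inversions_at ?\<sigma> m = 2 * m - 1 - inversions_at ?\<sigma> m"
    using assms(2) by (auto simp: inversions_at_def)
  then show ?thesis
    using assms(2)
    by (auto simp: code_B_def signed_inv_def perm_inv_def sign_exp_def Let_def inversions_at_def)
qed

lemma code_B_in_codes_B:
  assumes "\<pi> \<in> hyperoctahedral n"
  shows "code_B n \<pi> \<in> codes_B n"
proof -
  have "code_B n \<pi> m < 2 * m" if "m \<in> {1..n}" for m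
    using that code_B_eq[OF assms that] inversions_at_less[of m "underlying \<pi>"] by auto
  then show ?thesis unfolding codes_B_def code_B_def by (auto simp: PiE_iff)
qed

text \<open>An entry of the code at \<open>m\<close> is below \<open>m\<close> for a positive sign and at least \<open>m\<close> for a negative one,
  so it yields both the sign and the inversions of the underlying permutation.\<close>

lemma inj_on_code_B: "inj_on (code_B n) (hyperoctahedral n)"
proof (rule inj_onI)
  fix \<pi> \<rho> assume H: "\<pi> \<in> hyperoctahedral n" "\<rho> \<in> hyperoctahedral n" and eq: "code_B n \<pi> = code_B n \<rho>"
  have *: "inversions_at (underlying \<pi>) m = inversions_at (underlying \<rho>) m \<and>
           (\<pi> (int m) < 0 \<longleftrightarrow> \<rho> (int m) < 0)" if m: "m \<in> {1..n}" for m
  proof -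
    have "inversions_at (underlying \<pi>) m < m" "inversions_at (underlying \<rho>) m < m"
      using m by (simp_all add: inversions_at_less)
    then show ?thesis
      using code_B_eq[OF H(1) m] code_B_eq[OF H(2) m] fun_cong[OF eq, of m]
      by (cases "\<pi> (int m) < 0"; cases "\<rho> (int m) < 0"; simp; linarith)
  qed
  have pos: "\<pi> (int m) = \<rho> (int m)" if m: "m \<in> {1..n}" for m
  proof -
    have "underlying \<pi> m = underlying \<rho> m"
    proof (rule inversions_determine_injection[where \<sigma> = "underlying \<pi>" and \<tau> = "underlying \<rho>"])
      show "inj_on (underlying \<pi>) {1..n}" "inj_on (underlying \<rho>) {1..n}"
        using H by (blast intro: hyperoctahedralD)+
      show "underlying \<pi> ` {1..n} = underlying \<rho> ` {1..n}"
        by (simp only: underlying_image[OF H(1)] underlying_image[OF H(2)])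
    qed (use * m in blast)+
    then have "\<bar>\<pi> (int m)\<bar> = \<bar>\<rho> (int m)\<bar>" by (simp add: underlying_def)
    then show ?thesis using *[OF m] by linarith
  qed
  show "\<pi> = \<rho>"
  proof
    fix x :: int
    consider m where "m \<in> {1..n}" "x = int m" | m where "m \<in> {1..n}" "x = - int m"
      | "x \<notin> {- int n..-1} \<union> {1..int n}"
    proof -
      have "nat \<bar>x\<bar> \<in> {1..n}" "x = int (nat \<bar>x\<bar>) \<or> x = - int (nat \<bar>x\<bar>)"
        if "x \<in> {- int n..-1} \<union> {1..int n}" using that by auto
      then show thesis using that by blast
    qed
    then show "\<pi> x = \<rho> x"
      using pos hyperoctahedralD(3,4)[OF H(1)] hyperoctahedralD(3,4)[OF H(2)] by cases auto
  qed
qed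

text \<open>\<open>signed_perm \<sigma> S\<close> has underlying permutation \<open>\<sigma>\<close> and negative entries at the positions in \<open>S\<close>.
  These elements give the lower bound \<open>2 ^ n * n!\<close> for the order of the hyperoctahedral group, which
  is all that surjectivity of the code requires.\<close>

definition signed_perm :: "(nat \<Rightarrow> nat) \<Rightarrow> nat set \<Rightarrow> int \<Rightarrow> int" where
  "signed_perm \<sigma> S x =
     (if nat \<bar>x\<bar> \<in> S then - sgn x * int (\<sigma> (nat \<bar>x\<bar>)) else sgn x * int (\<sigma> (nat \<bar>x\<bar>)))"

lemma abs_signed_perm:
  "x \<noteq> 0 \<Longrightarrow> nat \<bar>signed_perm \<sigma> S x\<bar> = \<sigma> (nat \<bar>x\<bar>)"
  by (auto simp: signed_perm_def abs_mult sgn_if)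

lemma signed_perm_in_hyperoctahedral:
  assumes "\<sigma> permutes {1..n}" "S \<subseteq> {1..n}"
  shows "signed_perm \<sigma> S \<in> hyperoctahedral n"
proof -
  let ?X = "{- int n..-1} \<union> {1..int n}" and ?f = "signed_perm \<sigma> S"
  have X: "x \<in> ?X \<longleftrightarrow> nat \<bar>x\<bar> \<in> {1..n}" for x by auto
  have odd: "?f (- x) = - ?f x" for x by (simp add: signed_perm_def)
  have id: "?f x = x" if "x \<notin> ?X" for x
  proof -
    have "nat \<bar>x\<bar> \<notin> {1..n}" using that X by blast
    then have "\<sigma> (nat \<bar>x\<bar>) = nat \<bar>x\<bar>" "nat \<bar>x\<bar> \<notin> S"
      using assms permutes_not_in[OF assms(1)] by blast+
    then show ?thesis by (simp add: signed_perm_def sgn_if)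
  qed
  have sub: "?f ` ?X \<subseteq> ?X"
  proof (intro image_subsetI)
    fix x assume x: "x \<in> ?X"
    then have "nat \<bar>?f x\<bar> = \<sigma> (nat \<bar>x\<bar>)" by (intro abs_signed_perm) auto
    moreover have "\<sigma> (nat \<bar>x\<bar>) \<in> {1..n}"
      using x permutes_in_image[OF assms(1)] unfolding X by blast
    ultimately show "?f x \<in> ?X" unfolding X by simp
  qed
  have inj: "inj_on ?f ?X"
  proof (rule inj_onI)
    fix x y assume xy: "x \<in> ?X" "y \<in> ?X" "?f x = ?f y"
    then have "\<sigma> (nat \<bar>x\<bar>) = \<sigma> (nat \<bar>y\<bar>)"
      using abs_signed_perm[of x \<sigma> S] abs_signed_perm[of y \<sigma> S] by force
    then have "nat \<bar>x\<bar> = nat \<bar>y\<bar>" using permutes_inj[OF assms(1)] by (auto dest: injD)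
    then have "y = x \<or> y = - x" by auto
    moreover have "?f x \<noteq> 0" using sub xy(1) by fastforce
    ultimately show "x = y" using odd[of x] xy(3) by auto
  qed
  have "bij_betw ?f ?X ?X"
    using inj endo_inj_surj[OF _ sub inj] by (simp add: bij_betw_def)
  then have "?f permutes ?X" using id by (intro bij_imp_permutes) auto
  then show ?thesis using odd by (simp add: hyperoctahedral_def)
qed

lemma inj_on_signed_perm:
  "inj_on (\<lambda>(\<sigma>, S). signed_perm \<sigma> S) ({\<sigma>. \<sigma> permutes {1..n}} \<times> Pow {1..n})"
proof (rule inj_onI, clarify)
  fix \<sigma> \<tau> S S' assume H: "\<sigma> permutes {1..n}" "\<tau> permutes {1..n}" "S \<subseteq> {1..n}" "S' \<subseteq> {1..n}"
    and eq: "signed_perm \<sigma> S = signed_perm \<tau> S'"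
  have st: "\<sigma> m = \<tau> m" for m
  proof (cases "m \<in> {1..n}")
    case True
    then show ?thesis
      using abs_signed_perm[of "int m" \<sigma> S] abs_signed_perm[of "int m" \<tau> S'] eq by simp
  next
    case False
    then show ?thesis using H(1,2) by (simp add: permutes_not_in)
  qed
  have "m \<in> S \<longleftrightarrow> m \<in> S'" if m: "m \<in> {1..n}" for m
  proof -
    have "\<tau> m \<noteq> 0" using permutes_in_image[OF H(2), of m] m by auto
    then show ?thesis
      using fun_cong[OF eq, of "int m"] m st[of m] by (auto simp: signed_perm_def split: if_splits)
  qed
  then show "\<sigma> = \<tau> \<and> S = S'" using st H by blast
qed

lemma card_codes_B: "card (codes_B n) = fact n * 2 ^ n"
proof -
  have "(\<Prod>m=1..n. 2 * m) = fact n * 2 ^ n"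
    by (simp add: prod.distrib fact_prod mult.commute)
  then show ?thesis unfolding codes_B_def by (simp add: card_PiE)
qed

lemma bij_betw_code_B: "bij_betw (code_B n) (hyperoctahedral n) (codes_B n)"
proof -
  let ?P = "{\<sigma>. \<sigma> permutes {1..n}} \<times> Pow {1..n}"
  have sub: "code_B n ` hyperoctahedral n \<subseteq> codes_B n"
    using code_B_in_codes_B by blast
  have fin: "finite (codes_B n)" unfolding codes_B_def by (intro finite_PiE) auto
  have fin': "finite (hyperoctahedral n)"
    using finite_imageD[OF finite_subset[OF sub fin] inj_on_code_B] .
  have "(\<lambda>(\<sigma>, S). signed_perm \<sigma> S) ` ?P \<subseteq> hyperoctahedral n"
  proof (rule image_subsetI)
    fix z assume "z \<in> ?P"
    then obtain \<sigma> S where "z = (\<sigma>, S)" "\<sigma> permutes {1..n}" "S \<subseteq> {1..n}" by fast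
    then show "(case z of (\<sigma>, S) \<Rightarrow> signed_perm \<sigma> S) \<in> hyperoctahedral n"
      by (simp only: prod.case signed_perm_in_hyperoctahedral)
  qed
  then have "card ?P \<le> card (hyperoctahedral n)"
    by (rule card_inj_on_le[OF inj_on_signed_perm _ fin'])
  also have "card ?P = fact n * 2 ^ n"
    by (simp add: card_cartesian_product card_permutations card_Pow)
  finally have "card (codes_B n) \<le> card (code_B n ` hyperoctahedral n)"
    by (simp add: card_codes_B card_image[OF inj_on_code_B])
  then have "code_B n ` hyperoctahedral n = codes_B n"
    using sub fin by (intro card_seteq)
  then show ?thesis using inj_on_code_B by (simp add: bij_betw_def)
qed

section \<open>Comparison of the two generating functions\<close>

theorem proposition4p8:
  fixes n k :: nat
  assumes "n \<ge> 1" and "k \<le> n\<^sup>2"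
  shows "q_mahonian_B n k = (\<Sum>T\<in>tilings_B n k. q ^ tiling_weight T)"
proof -
  let ?C = "{x \<in> codes_B n. (\<Sum>m=1..n. x m) = k}"
  have "I_B n k = {\<pi> \<in> hyperoctahedral n. (\<Sum>m=1..n. code_B n \<pi> m) = k}"
    by (simp only: I_B_def inv_B_eq_sum_code)
  then have "bij_betw (code_B n) (I_B n k) ?C"
    using bij_betw_Collect[OF bij_betw_code_B, of n "\<lambda>x. (\<Sum>m=1..n. x m) = k"
        "\<lambda>\<pi>. (\<Sum>m=1..n. code_B n \<pi> m) = k"] by simp
  then have "q_mahonian_B n k = (\<Sum>x\<in>?C. q ^ (\<Sum>m=1..n. m * x m))"
    unfolding q_mahonian_B_def inv_weight_eq_sum_code by (rule sum.reindex_bij_betw)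
  also have "\<dots> = (\<Sum>x\<in>?C. q ^ tiling_weight (block_word x n))"
    by (simp only: tiling_weight_block_word)
  also have "\<dots> = (\<Sum>T\<in>tilings_B n k. q ^ tiling_weight T)"
    by (rule sum.reindex_bij_betw) (rule bij_betw_codes_tilings)
  finally show ?thesis .
qed

end
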